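(* For every instance of SEBP, $\mathrm{LEPT}_{\mathcal F}\le(1+e^{-1})\,OPT_{\mathcal P}$; that is, $\mathrm{LEPT}_{\mathcal F}$ is a $(1+e^{-1})$-approximation algorithm (with no restriction on the support of the processing times).
   Context: Stochastic extensible bin packing (SEBP): an instance $I=(\vec P,m)$ consists of $m$ identical machines, each with unit regular capacity, and $n>m$ jobs whose processing times $P_1,\dots,P_n$ are mutually independent nonnegative random variables with finite expectations. A scheduling policy maps each realization to a feasible schedule (start times and machine assignments, no machine processing two jobs at once) in a non-anticipatory way (decisions at time $t$ depend only on durations of jobs completed before $t$ and on conditional distributions of the rest). For a policy $\Pi$ the workload $X_i^\Pi$ of machine $i$ is the latest completion time of a job on $i$, and its cost is $\Phi(\Pi)=\mathbb E[\sum_i\max(X_i^\Pi,1)]$; $OPT_{\mathcal P}$ is the infimum of $\Phi$ over all scheduling policies. $\mathrm{LEPT}_{\mathcal F}$ is the fixed-assignment policy: jobs are considered in nonincreasing order of $\mathbb E[P_j]$ and each is assigned to a machine with currently smallest total expected load (sum of $\mathbb E[P_{j'}]$ of jobs already assigned to it); this assignment is fixed in advance and each machine processes its jobs without idle time. $\mathrm{LEPT}_{\mathcal F}$ also denotes its cost $\sum_i\mathbb E[\max(\sum_{j\to i}P_j,1)]$. *)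

theory Defs
  imports "HOL-Probability.Probability"
begin

text \<open>Jobs are the numbers below \<open>n\<close>, machines the numbers below \<open>m\<close>.\<close>

definition realizations :: "nat \<Rightarrow> (nat \<Rightarrow> real) measure" where
  "realizations n = PiM {..<n} (\<lambda>_. restrict_space borel {0..})"

record schedule =
  start :: "nat \<Rightarrow> real"
  machine :: "nat \<Rightarrow> nat"

definition feasible_schedule :: "nat \<Rightarrow> nat \<Rightarrow> (nat \<Rightarrow> real) \<Rightarrow> schedule \<Rightarrow> bool" where
  "feasible_schedule n m p S \<longleftrightarrow>
     (\<forall>j<n. 0 \<le> start S j \<and> machine S j < m) \<and>
     (\<forall>j<n. \<forall>k<n. j \<noteq> k \<and> machine S j = machine S k \<longrightarrow>
        start S j + p j \<le> start S k \<or> start S k + p k \<le> start S j)"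

text \<open>What is known at time \<open>t\<close> about a job of duration \<open>x\<close> started at time \<open>s\<close>: its exact
  duration once it is completed, otherwise only that it is still running.\<close>

definition observed :: "real \<Rightarrow> real \<Rightarrow> real \<Rightarrow> real option" where
  "observed s t x = (if s + x \<le> t then Some x else None)"

text \<open>The job \<open>\<sigma> p k\<close> is the one started in the \<open>k\<close>-th decision under realization \<open>p\<close>. This
  decision (job, time, machine) is determined by what has been observed, up to the time at which
  it is taken, about the jobs started in the earlier decisions. The processing time distributions
  are known in advance, so conditional distributions carry no further information. Since jobs may
  have duration zero, several dependent decisions can occur at the same time; the order \<open>\<sigma> p\<close>
  prevents circular dependencies among them.\<close>

definition non_anticipatory :: "nat \<Rightarrow> ((nat \<Rightarrow> real) \<Rightarrow> schedule) \<Rightarrow> bool" where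
  "non_anticipatory n \<pi> \<longleftrightarrow>
     (\<exists>\<sigma>. (\<forall>p\<in>space (realizations n).
             bij_betw (\<sigma> p) {..<n} {..<n} \<and>
             (\<forall>k<n. \<forall>l\<le>k. start (\<pi> p) (\<sigma> p l) \<le> start (\<pi> p) (\<sigma> p k))) \<and>
          (\<forall>p\<in>space (realizations n). \<forall>p'\<in>space (realizations n). \<forall>k<n.
             (\<forall>l<k. observed (start (\<pi> p) (\<sigma> p l)) (start (\<pi> p) (\<sigma> p k)) (p (\<sigma> p l)) =
                    observed (start (\<pi> p) (\<sigma> p l)) (start (\<pi> p) (\<sigma> p k)) (p' (\<sigma> p l))) \<longrightarrow>
             \<sigma> p' k = \<sigma> p k \<and>
             start (\<pi> p') (\<sigma> p k) = start (\<pi> p) (\<sigma> p k) \<and>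
             machine (\<pi> p') (\<sigma> p k) = machine (\<pi> p) (\<sigma> p k)))"

definition scheduling_policies :: "nat \<Rightarrow> nat \<Rightarrow> ((nat \<Rightarrow> real) \<Rightarrow> schedule) set" where
  "scheduling_policies n m =
     {\<pi>. (\<forall>p\<in>space (realizations n). feasible_schedule n m p (\<pi> p)) \<and>
         (\<forall>j<n. (\<lambda>p. start (\<pi> p) j) \<in> borel_measurable (realizations n)) \<and>
         (\<forall>j<n. (\<lambda>p. machine (\<pi> p) j) \<in> measurable (realizations n) (count_space UNIV)) \<and>
         non_anticipatory n \<pi>}"

text \<open>The value \<open>0\<close> is inserted to cover machines without jobs.\<close>

definition workload :: "nat \<Rightarrow> (nat \<Rightarrow> real) \<Rightarrow> schedule \<Rightarrow> nat \<Rightarrow> real" where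
  "workload n p S i = Max (insert 0 {start S j + p j | j. j < n \<and> machine S j = i})"

definition policy_cost ::
  "'a measure \<Rightarrow> (nat \<Rightarrow> 'a \<Rightarrow> real) \<Rightarrow> nat \<Rightarrow> nat \<Rightarrow> ((nat \<Rightarrow> real) \<Rightarrow> schedule) \<Rightarrow> ennreal" where
  "policy_cost M P n m \<pi> =
     (\<integral>\<^sup>+\<omega>. (let p = (\<lambda>j\<in>{..<n}. P j \<omega>)
            in ennreal (\<Sum>i<m. max (workload n p (\<pi> p) i) 1)) \<partial>M)"

definition opt_policy_cost ::
  "'a measure \<Rightarrow> (nat \<Rightarrow> 'a \<Rightarrow> real) \<Rightarrow> nat \<Rightarrow> nat \<Rightarrow> ennreal" where
  "opt_policy_cost M P n m = (INF \<pi>\<in>scheduling_policies n m. policy_cost M P n m \<pi>)"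

text \<open>An assignment \<open>a\<close> of jobs to machines that LEPT can produce for expected processing times
  \<open>\<mu>\<close>, under some way of breaking ties among jobs and among machines; \<open>\<tau>\<close> is the order in which
  the jobs are considered.\<close>

definition lept_assignment :: "(nat \<Rightarrow> real) \<Rightarrow> nat \<Rightarrow> nat \<Rightarrow> (nat \<Rightarrow> nat) \<Rightarrow> bool" where
  "lept_assignment \<mu> n m a \<longleftrightarrow>
     (\<exists>\<tau>. bij_betw \<tau> {..<n} {..<n} \<and>
          (\<forall>l<n. \<forall>k\<le>l. \<mu> (\<tau> l) \<le> \<mu> (\<tau> k)) \<and>
          (\<forall>k<n. a (\<tau> k) < m \<and>
             (\<forall>i<m. (\<Sum>j\<in>{j\<in>\<tau> ` {..<k}. a j = a (\<tau> k)}. \<mu> j)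
                     \<le> (\<Sum>j\<in>{j\<in>\<tau> ` {..<k}. a j = i}. \<mu> j))))"

definition fixed_assignment_cost ::
  "'a measure \<Rightarrow> (nat \<Rightarrow> 'a \<Rightarrow> real) \<Rightarrow> nat \<Rightarrow> nat \<Rightarrow> (nat \<Rightarrow> nat) \<Rightarrow> real" where
  "fixed_assignment_cost M P n m a =
     (\<Sum>i<m. \<integral>\<omega>. max (\<Sum>j\<in>{j\<in>{..<n}. a j = i}. P j \<omega>) 1 \<partial>M)"

end

theory Submission
  imports Defs
begin

text \<open>Split each processing time into \<open>min P\<^sub>j 1\<close> and \<open>max (P\<^sub>j - 1) 0\<close>, with expectations
  \<open>q\<^sub>j\<close> and \<open>r\<^sub>j\<close>; let \<open>Q\<close> and \<open>R\<close> be their sums over all jobs, \<open>Q\<^sub>i\<close> and \<open>R\<^sub>i\<close> those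
  over the jobs of machine \<open>i\<close>. The pointwise inequality
  \<open>max (\<Sum>P\<^sub>j) 1 \<le> \<Sum>P\<^sub>j + \<Prod>(1 - min P\<^sub>j 1)\<close> and independence bound the expected cost of a machine
  by its expected load plus \<open>\<Prod>(1 - q\<^sub>j)\<close>. If \<open>\<ell>\<close> is the smallest expected machine load, removing
  the last job from any machine leaves load at most \<open>\<ell>\<close>, and this implies
  \<open>\<Prod>(1 - q\<^sub>j) \<le> (1 + R\<^sub>i) / e + exp (- \<ell>) * (1 - Q\<^sub>i)\<close> on every machine \<open>i\<close>. Summing over the
  machines, the cost is at most \<open>(m + R) / e\<close> plus a convex combination of \<open>Q + R\<close> and \<open>m + R\<close>;
  both of these are lower bounds for the cost of every feasible schedule.\<close>

lemma mult_exp_minus_le: "x * exp (- x) \<le> exp (- 1)" for x :: real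
proof -
  have "x \<le> exp (x - 1)"
    using exp_ge_add_one_self[of "x - 1"] by simp
  then have "x * exp (- x) \<le> exp (x - 1) * exp (- x)"
    by (intro mult_right_mono) auto
  then show ?thesis
    by (simp flip: exp_add)
qed

lemma exp_minus_le_of_le_1:
  fixes y r l :: real
  assumes "0 \<le> y" "y \<le> 1" "0 \<le> r" "l \<le> y + r"
  shows "exp (- y) \<le> (1 + r) * exp (- 1) + exp (- l) * (1 - y)"
proof -
  have "exp (1 - y) \<le> 1 + (1 - y) + (1 - y)\<^sup>2"
    using exp_bound[of "1 - y"] assms by simp
  also have "\<dots> \<le> (1 + r) + (2 - (y + r)) * (1 - y)"
    using mult_nonneg_nonneg[OF assms(3,1)] by (simp add: algebra_simps power2_eq_square)
  also have "\<dots> \<le> (1 + r) + exp (1 - (y + r)) * (1 - y)"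
    using exp_ge_add_one_self[of "1 - (y + r)"] assms by (intro add_left_mono mult_right_mono) auto
  finally have "exp (- 1) * exp (1 - y) \<le> exp (- 1) * ((1 + r) + exp (1 - (y + r)) * (1 - y))"
    by (intro mult_left_mono) auto
  then have "exp (- y) \<le> (1 + r) * exp (- 1) + exp (- (y + r)) * (1 - y)"
    by (simp add: algebra_simps flip: exp_add)
  also have "\<dots> \<le> (1 + r) * exp (- 1) + exp (- l) * (1 - y)"
    using assms by (intro add_left_mono mult_right_mono) auto
  finally show ?thesis .
qed

lemma prod_one_minus_le_exp:
  fixes q :: "'b \<Rightarrow> real"
  assumes "\<And>j. j \<in> J \<Longrightarrow> q j \<le> 1"
  shows "(\<Prod>j\<in>J. 1 - q j) \<le> exp (- (\<Sum>j\<in>J. q j))"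
proof (cases "finite J")
  case True
  have "(\<Prod>j\<in>J. 1 - q j) \<le> (\<Prod>j\<in>J. exp (- q j))"
    using assms exp_ge_add_one_self[of "- q _"] by (intro prod_mono) auto
  then show ?thesis
    using True by (simp add: exp_sum flip: sum_negf)
qed simp

lemma prod_one_minus_le_greedy:
  fixes q r :: "'b \<Rightarrow> real"
  assumes "finite J"
    and q: "\<And>j. j \<in> J \<Longrightarrow> 0 \<le> q j" "\<And>j. j \<in> J \<Longrightarrow> q j \<le> 1"
    and r: "\<And>j. j \<in> J \<Longrightarrow> 0 \<le> r j"
    and l: "l \<le> (\<Sum>j\<in>J. q j + r j)"
    and last: "J \<noteq> {} \<Longrightarrow> \<exists>j\<in>J. (\<Sum>k\<in>J - {j}. q k + r k) \<le> l"
  shows "(\<Prod>j\<in>J. 1 - q j)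
           \<le> (1 + (\<Sum>j\<in>J. r j)) * exp (- 1) + exp (- l) * (1 - (\<Sum>j\<in>J. q j))"
proof (cases "(\<Sum>j\<in>J. q j) \<le> 1")
  case True
  have "(\<Prod>j\<in>J. 1 - q j) \<le> exp (- (\<Sum>j\<in>J. q j))"
    using q by (intro prod_one_minus_le_exp)
  also have "\<dots> \<le> (1 + (\<Sum>j\<in>J. r j)) * exp (- 1) + exp (- l) * (1 - (\<Sum>j\<in>J. q j))"
    using True l q r by (intro exp_minus_le_of_le_1) (auto simp: sum_nonneg sum.distrib)
  finally show ?thesis .
next
  case False
  then have "J \<noteq> {}" by auto
  with last obtain j where j: "j \<in> J" "(\<Sum>k\<in>J - {j}. q k + r k) \<le> l" by blast
  define y where "y = (\<Sum>k\<in>J - {j}. q k)"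
  have y: "(\<Sum>k\<in>J. q k) = q j + y"
    using \<open>finite J\<close> j by (simp add: y_def sum.remove)
  have "y \<le> (\<Sum>k\<in>J - {j}. q k + r k)"
    unfolding y_def using r by (intro sum_mono) auto
  with j have "y \<le> l" by simp
  have "(\<Prod>k\<in>J. 1 - q k) = (1 - q j) * (\<Prod>k\<in>J - {j}. 1 - q k)"
    using \<open>finite J\<close> j by (simp add: prod.remove)
  also have "\<dots> \<le> (1 - q j) * exp (- y)"
    unfolding y_def using q j by (intro mult_left_mono prod_one_minus_le_exp) auto
  also have "\<dots> = y * exp (- y) + exp (- y) * (1 - (q j + y))"
    by (simp add: algebra_simps)
  also have "\<dots> \<le> exp (- 1) + exp (- l) * (1 - (q j + y))"
    using False y \<open>y \<le> l\<close>
    by (intro add_mono mult_exp_minus_le mult_right_mono_neg) auto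
  also have "\<dots> \<le> (1 + (\<Sum>j\<in>J. r j)) * exp (- 1) + exp (- l) * (1 - (q j + y))"
    using sum_nonneg[of J r] r by (simp add: algebra_simps)
  finally show ?thesis
    by (simp add: y)
qed

lemma max_sum_1_le:
  fixes p :: "'b \<Rightarrow> real"
  assumes "\<And>j. j \<in> J \<Longrightarrow> 0 \<le> p j"
  shows "max (\<Sum>j\<in>J. p j) 1 \<le> (\<Sum>j\<in>J. p j) + (\<Prod>j\<in>J. 1 - min (p j) 1)"
proof -
  have "1 - (\<Sum>j\<in>J. p j) \<le> (\<Prod>j\<in>J. 1 - min (p j) 1)"
  proof -
    have "1 - (\<Sum>j\<in>J. p j) \<le> 1 - (\<Sum>j\<in>J. min (p j) 1)"
      by (intro diff_left_mono sum_mono) auto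
    also have "\<dots> \<le> (\<Prod>j\<in>J. 1 - min (p j) 1)"
      using assms by (intro Weierstrass_prod_ineq) auto
    finally show ?thesis .
  qed
  moreover have "0 \<le> (\<Prod>j\<in>J. 1 - min (p j) 1)"
    by (intro prod_nonneg) auto
  ultimately show ?thesis by auto
qed

lemma one_plus_sum_excess_le:
  fixes p :: "'b \<Rightarrow> real"
  assumes "\<And>j. j \<in> J \<Longrightarrow> 0 \<le> p j"
  shows "1 + (\<Sum>j\<in>J. max (p j - 1) 0) \<le> max (\<Sum>j\<in>J. p j) 1"
  using assms
proof (induction J rule: infinite_finite_induct)
  case (insert k J)
  have "0 \<le> (\<Sum>j\<in>J. p j)"
    using insert.prems by (intro sum_nonneg) auto
  moreover have "0 \<le> p k"
    using insert.prems by simp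
  moreover have "1 + (\<Sum>j\<in>J. max (p j - 1) 0) \<le> max (\<Sum>j\<in>J. p j) 1"
    using insert.prems by (intro insert.IH) auto
  ultimately show ?case
    using insert.hyps by simp
qed auto

lemma sum_disjoint_durations_le:
  fixes s p :: "'b \<Rightarrow> real"
  assumes "finite J" "0 \<le> W"
    and "\<And>j. j \<in> J \<Longrightarrow> 0 \<le> s j" "\<And>j. j \<in> J \<Longrightarrow> 0 < p j" "\<And>j. j \<in> J \<Longrightarrow> s j + p j \<le> W"
    and "\<And>j k. j \<in> J \<Longrightarrow> k \<in> J \<Longrightarrow> j \<noteq> k \<Longrightarrow> s j + p j \<le> s k \<or> s k + p k \<le> s j"
  shows "(\<Sum>j\<in>J. p j) \<le> W"
  using assms
proof (induction J arbitrary: W rule: finite_ranking_induct[where f = s])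
  case (insert x J)
  show ?case
  proof (cases "x \<in> J")
    case True
    then show ?thesis using insert by (simp add: insert_absorb)
  next
    case False
    have "s k + p k \<le> s x" if "k \<in> J" for k
      using insert.prems(3,5)[of x] insert.prems(5)[of k x] insert.hyps(2)[OF that] that False
        insert.prems(3)[of x] by force
    then have "(\<Sum>j\<in>J. p j) \<le> s x"
      using insert.prems by (intro insert.IH) auto
    then show ?thesis
      using insert.prems(4)[of x] False insert.hyps(1) by simp
  qed
qed simp

lemma sum_le_workload:
  assumes S: "feasible_schedule n m p S" and p: "\<And>j. j < n \<Longrightarrow> 0 \<le> p j"
  shows "(\<Sum>j | j < n \<and> machine S j = i. p j) \<le> workload n p S i"
proof -
  define J where "J = {j. j < n \<and> machine S j = i}"
  have fin: "finite (insert 0 {start S j + p j | j. j < n \<and> machine S j = i})"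
    by simp
  have le: "start S j + p j \<le> workload n p S i" if "j \<in> J" for j
    unfolding workload_def using that by (intro Max_ge fin) (auto simp: J_def)
  have "0 \<le> workload n p S i"
    unfolding workload_def by (intro Max_ge fin) auto
  then have "(\<Sum>j\<in>{j\<in>J. 0 < p j}. p j) \<le> workload n p S i"
    using S le by (intro sum_disjoint_durations_le[where s = "start S"])
      (auto simp: feasible_schedule_def J_def)
  moreover have "(\<Sum>j\<in>{j\<in>J. 0 < p j}. p j) = (\<Sum>j\<in>J. p j)"
    using p by (intro sum.mono_neutral_left) (force simp: J_def)+
  ultimately show ?thesis
    by (simp add: J_def)
qed

lemma sum_machines:
  fixes f :: "nat \<Rightarrow> real" and a :: "nat \<Rightarrow> nat"
  assumes "\<And>j. j < n \<Longrightarrow> a j < m"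
  shows "(\<Sum>i<m. \<Sum>j | j < n \<and> a j = i. f j) = (\<Sum>j<n. f j)"
  using sum.group[of "{..<n}" "{..<m}" a f] assms by (simp add: image_subset_iff)

lemma schedule_cost_ge:
  assumes S: "feasible_schedule n m p S" and p: "\<And>j. j < n \<Longrightarrow> 0 \<le> p j"
  shows "(\<Sum>j<n. p j) \<le> (\<Sum>i<m. max (workload n p S i) 1)"
    and "m + (\<Sum>j<n. max (p j - 1) 0) \<le> (\<Sum>i<m. max (workload n p S i) 1)"
proof -
  have machine: "\<And>j. j < n \<Longrightarrow> machine S j < m"
    using S by (auto simp: feasible_schedule_def)
  have "(\<Sum>j<n. p j) = (\<Sum>i<m. \<Sum>j | j < n \<and> machine S j = i. p j)"
    by (intro sum_machines[symmetric] machine)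
  also have "\<dots> \<le> (\<Sum>i<m. max (workload n p S i) 1)"
    using sum_le_workload[OF S p] by (intro sum_mono) (simp add: le_max_iff_disj)
  finally show "(\<Sum>j<n. p j) \<le> (\<Sum>i<m. max (workload n p S i) 1)" .
  have "m + (\<Sum>j<n. max (p j - 1) 0)
      = (\<Sum>i<m. 1 + (\<Sum>j | j < n \<and> machine S j = i. max (p j - 1) 0))"
    by (simp add: sum.distrib sum_machines machine)
  also have "\<dots> \<le> (\<Sum>i<m. max (\<Sum>j | j < n \<and> machine S j = i. p j) 1)"
    using p by (intro sum_mono one_plus_sum_excess_le) auto
  also have "\<dots> \<le> (\<Sum>i<m. max (workload n p S i) 1)"
    using sum_le_workload[OF S p] by (intro sum_mono max.mono) auto
  finally show "m + (\<Sum>j<n. max (p j - 1) 0) \<le> (\<Sum>i<m. max (workload n p S i) 1)" .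
qed

lemma le_opt_policy_cost:
  assumes P: "\<And>j \<omega>. j < n \<Longrightarrow> \<omega> \<in> space M \<Longrightarrow> 0 \<le> P j \<omega>"
    and f: "integrable M f" "\<And>\<omega>. \<omega> \<in> space M \<Longrightarrow> 0 \<le> f \<omega>"
    and le: "\<And>\<omega> S. \<omega> \<in> space M \<Longrightarrow> feasible_schedule n m (\<lambda>j\<in>{..<n}. P j \<omega>) S \<Longrightarrow>
      f \<omega> \<le> (\<Sum>i<m. max (workload n (\<lambda>j\<in>{..<n}. P j \<omega>) S i) 1)"
  shows "ennreal (\<integral>\<omega>. f \<omega> \<partial>M) \<le> opt_policy_cost M P n m"
  unfolding opt_policy_cost_def
proof (rule INF_greatest)
  fix \<pi> assume \<pi>: "\<pi> \<in> scheduling_policies n m"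
  have "feasible_schedule n m (\<lambda>j\<in>{..<n}. P j \<omega>) (\<pi> (\<lambda>j\<in>{..<n}. P j \<omega>))" if "\<omega> \<in> space M" for \<omega>
  proof -
    have "(\<lambda>j\<in>{..<n}. P j \<omega>) \<in> space (realizations n)"
      using P that by (auto simp: realizations_def space_PiM space_restrict_space)
    with \<pi> show ?thesis by (auto simp: scheduling_policies_def)
  qed
  then have "(\<integral>\<^sup>+\<omega>. ennreal (f \<omega>) \<partial>M) \<le> policy_cost M P n m \<pi>"
    unfolding policy_cost_def Let_def by (intro nn_integral_mono ennreal_leI le)
  moreover have "(\<integral>\<^sup>+\<omega>. ennreal (f \<omega>) \<partial>M) = ennreal (\<integral>\<omega>. f \<omega> \<partial>M)"
    using f by (intro nn_integral_eq_integral) auto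
  ultimately show "ennreal (\<integral>\<omega>. f \<omega> \<partial>M) \<le> policy_cost M P n m \<pi>" by simp
qed

lemma lept_assignment_less:
  assumes "lept_assignment \<mu> n m a" "j < n"
  shows "a j < m"
proof -
  obtain \<tau> where "bij_betw \<tau> {..<n} {..<n}" and a: "\<And>k. k < n \<Longrightarrow> a (\<tau> k) < m"
    using assms(1) by (auto simp: lept_assignment_def)
  with assms(2) obtain k where "k < n" "\<tau> k = j"
    by (metis bij_betw_imp_surj_on imageE lessThan_iff)
  with a show ?thesis by auto
qed

lemma lept_assignment_last_job:
  assumes lept: "lept_assignment \<mu> n m a" and \<mu>: "\<And>j. j < n \<Longrightarrow> 0 \<le> \<mu> j"
    and ne: "{j. j < n \<and> a j = i} \<noteq> {}"
  shows "\<exists>j\<in>{j. j < n \<and> a j = i}. \<forall>i'<m.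
    (\<Sum>k\<in>{j. j < n \<and> a j = i} - {j}. \<mu> k) \<le> (\<Sum>k | k < n \<and> a k = i'. \<mu> k)"
proof -
  obtain \<tau> where \<tau>: "bij_betw \<tau> {..<n} {..<n}" and
    a: "\<And>k i'. k < n \<Longrightarrow> i' < m \<Longrightarrow> (\<Sum>j\<in>{j\<in>\<tau> ` {..<k}. a j = a (\<tau> k)}. \<mu> j)
                     \<le> (\<Sum>j\<in>{j\<in>\<tau> ` {..<k}. a j = i'}. \<mu> j)"
    using lept by (auto simp: lept_assignment_def)
  define K where "K = {k. k < n \<and> a (\<tau> k) = i}"
  define k where "k = Max K"
  have surj: "\<exists>l<n. \<tau> l = j" if "j < n" for j
    using \<tau> that by (metis bij_betw_imp_surj_on imageE lessThan_iff)
  have less: "\<tau> l < n" if "l < n" for l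
    using \<tau> that by (auto simp: bij_betw_def)
  have "finite K" by (simp add: K_def)
  moreover have "K \<noteq> {}" using ne surj by (fastforce simp: K_def)
  ultimately have k: "k \<in> K" and kmax: "\<And>l. l \<in> K \<Longrightarrow> l \<le> k"
    by (auto simp: k_def)
  have kn: "k < n" and ak: "a (\<tau> k) = i" using k by (auto simp: K_def)
  have sub: "{j. j < n \<and> a j = i} - {\<tau> k} \<subseteq> {j\<in>\<tau> ` {..<k}. a j = a (\<tau> k)}"
  proof
    fix j assume j: "j \<in> {j. j < n \<and> a j = i} - {\<tau> k}"
    then obtain l where l: "l < n" "\<tau> l = j" using surj by auto
    with j have "l \<in> K" "l \<noteq> k" by (auto simp: K_def)
    with kmax[of l] l j ak show "j \<in> {j\<in>\<tau> ` {..<k}. a j = a (\<tau> k)}" by force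
  qed
  have "(\<Sum>j\<in>{j. j < n \<and> a j = i} - {\<tau> k}. \<mu> j) \<le> (\<Sum>j | j < n \<and> a j = i'. \<mu> j)" if "i' < m" for i'
  proof -
    have "(\<Sum>j\<in>{j. j < n \<and> a j = i} - {\<tau> k}. \<mu> j) \<le> (\<Sum>j\<in>{j\<in>\<tau> ` {..<k}. a j = a (\<tau> k)}. \<mu> j)"
      using sub \<mu> less kn by (intro sum_mono2) auto
    also have "\<dots> \<le> (\<Sum>j\<in>{j\<in>\<tau> ` {..<k}. a j = i'}. \<mu> j)"
      using a[OF kn that] .
    also have "\<dots> \<le> (\<Sum>j | j < n \<and> a j = i'. \<mu> j)"
      using \<mu> less kn by (intro sum_mono2) auto
    finally show ?thesis .
  qed
  then show ?thesis
    using less[OF kn] ak by (intro bexI[of _ "\<tau> k"]) auto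
qed

lemma (in prob_space) expectation_max_sum_1_le:
  fixes P :: "'b \<Rightarrow> 'a \<Rightarrow> real"
  assumes "finite J" and indep: "indep_vars (\<lambda>_. borel) P J"
    and nonneg: "\<And>j \<omega>. j \<in> J \<Longrightarrow> \<omega> \<in> space M \<Longrightarrow> 0 \<le> P j \<omega>"
    and int: "\<And>j. j \<in> J \<Longrightarrow> integrable M (P j)"
  shows "(\<integral>\<omega>. max (\<Sum>j\<in>J. P j \<omega>) 1 \<partial>M)
    \<le> (\<Sum>j\<in>J. \<integral>\<omega>. P j \<omega> \<partial>M) + (\<Prod>j\<in>J. 1 - (\<integral>\<omega>. min (P j \<omega>) 1 \<partial>M))"
proof -
  have indep': "indep_vars (\<lambda>_. borel) (\<lambda>j \<omega>. 1 - min (P j \<omega>) 1) J"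
    by (rule indep_vars_compose2[OF indep]) auto
  have int': "integrable M (\<lambda>\<omega>. 1 - min (P j \<omega>) 1)" if "j \<in> J" for j
    using int[OF that] by auto
  have "(\<integral>\<omega>. max (\<Sum>j\<in>J. P j \<omega>) 1 \<partial>M)
    \<le> (\<integral>\<omega>. (\<Sum>j\<in>J. P j \<omega>) + (\<Prod>j\<in>J. 1 - min (P j \<omega>) 1) \<partial>M)"
    using nonneg int indep_vars_integrable[OF \<open>finite J\<close> indep' int']
    by (intro integral_mono max_sum_1_le) auto
  also have "\<dots> = (\<Sum>j\<in>J. \<integral>\<omega>. P j \<omega> \<partial>M) + (\<integral>\<omega>. (\<Prod>j\<in>J. 1 - min (P j \<omega>) 1) \<partial>M)"
    using int indep_vars_integrable[OF \<open>finite J\<close> indep' int'] by simp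
  also have "(\<integral>\<omega>. (\<Prod>j\<in>J. 1 - min (P j \<omega>) 1) \<partial>M) = (\<Prod>j\<in>J. \<integral>\<omega>. 1 - min (P j \<omega>) 1 \<partial>M)"
    by (rule indep_vars_lebesgue_integral[OF \<open>finite J\<close> indep' int'])
  also have "\<dots> = (\<Prod>j\<in>J. 1 - (\<integral>\<omega>. min (P j \<omega>) 1 \<partial>M))"
    using int by (intro prod.cong) (auto simp: prob_space)
  finally show ?thesis .
qed

theorem theorem3:
  fixes M :: "'a measure" and P :: "nat \<Rightarrow> 'a \<Rightarrow> real" and n m :: nat and a :: "nat \<Rightarrow> nat"
  assumes "prob_space M"
    and "0 < m" and "m < n"
    and "prob_space.indep_vars M (\<lambda>_. borel) P {..<n}"
    and "\<And>j \<omega>. j < n \<Longrightarrow> \<omega> \<in> space M \<Longrightarrow> 0 \<le> P j \<omega>"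
    and "\<And>j. j < n \<Longrightarrow> integrable M (P j)"
    and "lept_assignment (\<lambda>j. \<integral>\<omega>. P j \<omega> \<partial>M) n m a"
  shows "ennreal (fixed_assignment_cost M P n m a)
           \<le> ennreal (1 + exp (- 1)) * opt_policy_cost M P n m"
proof -
  interpret prob_space M by fact
  note P = assms(5) and int = assms(6) and lept = assms(7)
  define \<mu> where "\<mu> j = (\<integral>\<omega>. P j \<omega> \<partial>M)" for j
  define q where "q j = (\<integral>\<omega>. min (P j \<omega>) 1 \<partial>M)" for j
  define r where "r j = (\<integral>\<omega>. max (P j \<omega> - 1) 0 \<partial>M)" for j
  define J where "J i = {j. j < n \<and> a j = i}" for i
  define l where "l = Min ((\<lambda>i. \<Sum>j\<in>J i. \<mu> j) ` {..<m})"
  have fin: "finite (J i)" for i by (simp add: J_def)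
  have int_r: "integrable M (\<lambda>\<omega>. max (P j \<omega> - 1) 0)" if "j < n" for j
    using int[OF that] by auto
  have q0: "0 \<le> q j" if "j < n" for j
    unfolding q_def using P[OF that] by (intro integral_nonneg_AE) auto
  have q1: "q j \<le> 1" if "j < n" for j
  proof -
    have "q j \<le> (\<integral>\<omega>. 1 \<partial>M)"
      unfolding q_def using int[OF that] by (intro integral_mono) auto
    then show ?thesis by (simp add: prob_space)
  qed
  have r0: "0 \<le> r j" for j
    unfolding r_def by (intro integral_nonneg_AE) auto
  have \<mu>_eq: "\<mu> j = q j + r j" if "j < n" for j
  proof -
    have "q j + r j = (\<integral>\<omega>. min (P j \<omega>) 1 + max (P j \<omega> - 1) 0 \<partial>M)"
      unfolding q_def r_def using int[OF that] by (intro Bochner_Integration.integral_add[symmetric]) auto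
    also have "\<dots> = \<mu> j"
      unfolding \<mu>_def by (intro Bochner_Integration.integral_cong) auto
    finally show ?thesis ..
  qed
  have \<mu>0: "0 \<le> \<mu> j" if "j < n" for j
    using \<mu>_eq q0 r0 that by auto
  have \<mu>_sum: "(\<Sum>j\<in>A. q j + r j) = (\<Sum>j\<in>A. \<mu> j)" if "A \<subseteq> {..<n}" for A
    using that \<mu>_eq by (intro sum.cong) auto
  have l_le: "l \<le> (\<Sum>j\<in>J i. \<mu> j)" if "i < m" for i
    unfolding l_def using that by (intro Min_le) auto
  have "l \<in> (\<lambda>i. \<Sum>j\<in>J i. \<mu> j) ` {..<m}"
    unfolding l_def using \<open>0 < m\<close> by (intro Min_in) auto
  then obtain i0 where i0: "i0 < m" "l = (\<Sum>j\<in>J i0. \<mu> j)" by auto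
  have l0: "0 \<le> l"
    unfolding i0(2) using \<mu>0 by (intro sum_nonneg) (auto simp: J_def)

  have machine: "(\<integral>\<omega>. max (\<Sum>j\<in>J i. P j \<omega>) 1 \<partial>M) \<le> (\<Sum>j\<in>J i. \<mu> j) +
    ((1 + (\<Sum>j\<in>J i. r j)) * exp (- 1) + exp (- l) * (1 - (\<Sum>j\<in>J i. q j)))" if "i < m" for i
  proof -
    have "indep_vars (\<lambda>_. borel) P (J i)"
      by (rule indep_vars_subset[OF assms(4)]) (auto simp: J_def)
    then have "(\<integral>\<omega>. max (\<Sum>j\<in>J i. P j \<omega>) 1 \<partial>M) \<le> (\<Sum>j\<in>J i. \<mu> j) + (\<Prod>j\<in>J i. 1 - q j)"
      unfolding \<mu>_def q_def using P int fin
      by (intro expectation_max_sum_1_le) (auto simp: J_def)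
    moreover have "\<exists>j\<in>J i. (\<Sum>k\<in>J i - {j}. q k + r k) \<le> l" if "J i \<noteq> {}"
    proof -
      have "\<exists>j\<in>J i. \<forall>i'<m. (\<Sum>k\<in>J i - {j}. \<mu> k) \<le> (\<Sum>k\<in>J i'. \<mu> k)"
        unfolding J_def
        by (rule lept_assignment_last_job[OF lept[folded \<mu>_def] \<mu>0])
           (use that in \<open>simp_all add: J_def\<close>)
      then obtain j where "j \<in> J i" "(\<Sum>k\<in>J i - {j}. \<mu> k) \<le> l"
        using i0 by auto
      moreover have "(\<Sum>k\<in>J i - {j}. q k + r k) = (\<Sum>k\<in>J i - {j}. \<mu> k)"
        by (intro \<mu>_sum) (auto simp: J_def)
      ultimately show ?thesis by (intro bexI[of _ j]) linarith
    qed
    moreover have "l \<le> (\<Sum>j\<in>J i. q j + r j)"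
      using l_le[OF that] by (subst \<mu>_sum) (auto simp: J_def)
    ultimately show ?thesis
      using prod_one_minus_le_greedy[OF fin, of i q r l] q0 q1 r0 by (simp add: J_def)
  qed

  define X where "X = (\<Sum>j<n. \<mu> j)"
  define Y where "Y = m + (\<Sum>j<n. r j)"
  have Q: "(\<Sum>j<n. q j) = X - (\<Sum>j<n. r j)"
    using \<mu>_eq by (simp add: X_def sum.distrib)
  have a: "\<And>j. j < n \<Longrightarrow> a j < m"
    by (rule lept_assignment_less[OF lept])
  have "fixed_assignment_cost M P n m a = (\<Sum>i<m. \<integral>\<omega>. max (\<Sum>j\<in>J i. P j \<omega>) 1 \<partial>M)"
    by (simp add: fixed_assignment_cost_def J_def)
  also have "\<dots> \<le> (\<Sum>i<m. (\<Sum>j\<in>J i. \<mu> j) +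
      ((1 + (\<Sum>j\<in>J i. r j)) * exp (- 1) + exp (- l) * (1 - (\<Sum>j\<in>J i. q j))))"
    using machine by (intro sum_mono) auto
  also have "\<dots> = X + (Y * exp (- 1) + exp (- l) * (m - (\<Sum>j<n. q j)))"
    unfolding X_def Y_def J_def
    by (simp add: sum.distrib sum_subtractf sum_machines a flip: sum_distrib_left sum_distrib_right)
  also have "\<dots> = Y * exp (- 1) + ((1 - exp (- l)) * X + exp (- l) * Y)"
    by (simp add: Q Y_def algebra_simps)
  also have "\<dots> \<le> max X Y * exp (- 1) + ((1 - exp (- l)) * max X Y + exp (- l) * max X Y)"
    using l0 by (intro add_mono mult_left_mono mult_right_mono) auto
  also have "\<dots> = (1 + exp (- 1)) * max X Y"
    by (simp add: algebra_simps)
  finally have upper: "fixed_assignment_cost M P n m a \<le> (1 + exp (- 1)) * max X Y" .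

  have "ennreal (\<integral>\<omega>. (\<Sum>j<n. P j \<omega>) \<partial>M) \<le> opt_policy_cost M P n m"
  proof (rule le_opt_policy_cost)
    fix \<omega> S assume "\<omega> \<in> space M" "feasible_schedule n m (\<lambda>j\<in>{..<n}. P j \<omega>) S"
    then show "(\<Sum>j<n. P j \<omega>) \<le> (\<Sum>i<m. max (workload n (\<lambda>j\<in>{..<n}. P j \<omega>) S i) 1)"
      using schedule_cost_ge(1)[of n m "\<lambda>j\<in>{..<n}. P j \<omega>" S] P by simp
  qed (use P int in \<open>auto intro!: sum_nonneg\<close>)
  then have "ennreal X \<le> opt_policy_cost M P n m"
    using int by (simp add: X_def \<mu>_def)
  moreover have "ennreal Y \<le> opt_policy_cost M P n m"
  proof -
    have int_sum: "integrable M (\<lambda>\<omega>. \<Sum>j<n. max (P j \<omega> - 1) 0)"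
      using int_r by (intro Bochner_Integration.integrable_sum) auto
    have "(\<integral>\<omega>. m + (\<Sum>j<n. max (P j \<omega> - 1) 0) \<partial>M) = m + (\<integral>\<omega>. (\<Sum>j<n. max (P j \<omega> - 1) 0) \<partial>M)"
      by (subst Bochner_Integration.integral_add[OF _ int_sum]) (auto simp: prob_space)
    also have "\<dots> = Y"
      unfolding Y_def r_def using int_r by (subst Bochner_Integration.integral_sum) auto
    finally have Y: "(\<integral>\<omega>. m + (\<Sum>j<n. max (P j \<omega> - 1) 0) \<partial>M) = Y" .
    show ?thesis
      unfolding Y[symmetric]
    proof (rule le_opt_policy_cost)
      fix \<omega> S assume "\<omega> \<in> space M" "feasible_schedule n m (\<lambda>j\<in>{..<n}. P j \<omega>) S"
      then show "m + (\<Sum>j<n. max (P j \<omega> - 1) 0)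
          \<le> (\<Sum>i<m. max (workload n (\<lambda>j\<in>{..<n}. P j \<omega>) S i) 1)"
        using schedule_cost_ge(2)[of n m "\<lambda>j\<in>{..<n}. P j \<omega>" S] P by simp
    qed (use P int_sum in \<open>auto intro!: sum_nonneg add_nonneg_nonneg\<close>)
  qed
  ultimately have lower: "ennreal (max X Y) \<le> opt_policy_cost M P n m"
    by (simp add: max_def)

  have "ennreal (fixed_assignment_cost M P n m a) \<le> ennreal ((1 + exp (- 1)) * max X Y)"
    by (rule ennreal_leI[OF upper])
  also have "\<dots> = ennreal (1 + exp (- 1)) * ennreal (max X Y)"
    by (rule ennreal_mult') (simp add: add_nonneg_nonneg)
  also have "\<dots> \<le> ennreal (1 + exp (- 1)) * opt_policy_cost M P n m"
    by (intro mult_left_mono lower) simp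
  finally show ?thesis .
qed

end
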